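(* Let $G$ be a finite abelian group of odd order $n$ with $n>1$ (equivalently, $G$ nontrivial and the center of $D(G)$ is trivial), and let $\Gamma=\mathfrak{C}(D(G),D(G))$. Then the resolving polynomial of $\Gamma$ is \[\beta(\Gamma,x)=x^{2n-3}\big(x^3+2nx^2+(n^2+n-1)x+n(n-1)\big).\]
   Context: $D(G)=G\rtimes C_2$, $C_2=\{1,-1\}$, has elements $(g,c)$ with multiplication $(g_1,c_1)(g_2,c_2)=(g_1g_2^{c_1},c_1c_2)$; its center is $\{(g,1):g^2=e\}$, which is trivial exactly when $|G|$ is odd. The commuting graph $\mathfrak{C}(D(G),D(G))$ is the simple graph with vertex set $D(G)$ in which distinct $u,v$ are adjacent iff $uv=vu$. A set $W$ of vertices of a connected graph is resolving if every vertex is uniquely determined by its vector of shortest-path distances to the vertices of $W$; $\beta(\Gamma)$ is the minimum size of a resolving set. The resolving polynomial is $\beta(\Gamma,x)=\sum_{i=\beta(\Gamma)}^{|V(\Gamma)|}s_ix^i$, where $s_i$ is the number of resolving sets of $\Gamma$ of cardinality $i$. *)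

theory Defs
  imports
    "HOL-Algebra.Coset"
    "HOL-Computational_Algebra.Polynomial"
    "Graph_Theory.Graph_Theory"
begin

text \<open>The generalized dihedral group of \<open>G\<close>; the cyclic group of order two is realised as
  the multiplicative group \<open>{1, -1}\<close> of integers.\<close>

definition gen_dihedral :: "('a, 'b) monoid_scheme \<Rightarrow> ('a \<times> int) monoid" where
  "gen_dihedral G =
    \<lparr> carrier = carrier G \<times> {1, -1},
      monoid.mult = (\<lambda>(g\<^sub>1, c\<^sub>1) (g\<^sub>2, c\<^sub>2). (g\<^sub>1 \<otimes>\<^bsub>G\<^esub> (g\<^sub>2 [^]\<^bsub>G\<^esub> c\<^sub>1), c\<^sub>1 * c\<^sub>2)),
      one = (\<one>\<^bsub>G\<^esub>, 1) \<rparr>"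

lemma group_gen_dihedral:
  assumes "comm_group G"
  shows "group (gen_dihedral G)"
proof -
  interpret comm_group G by fact
  show ?thesis
  proof (rule groupI)
    fix x assume "x \<in> carrier (gen_dihedral G)"
    then obtain g c where "x = (g, c)" "g \<in> carrier G" "c = 1 \<or> c = -1"
      by (auto simp: gen_dihedral_def)
    then show "\<exists>y\<in>carrier (gen_dihedral G). y \<otimes>\<^bsub>gen_dihedral G\<^esub> x = \<one>\<^bsub>gen_dihedral G\<^esub>"
      by (intro bexI[of _ "(if c = 1 then inv\<^bsub>G\<^esub> g else g, c)"])
         (auto simp: gen_dihedral_def int_pow_neg)
  qed (auto simp: gen_dihedral_def int_pow_neg m_ac inv_mult)
qed

text \<open>The commuting graph on a set \<open>\<Omega>\<close> of elements. An undirected edge is represented by the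
  two opposite arcs.\<close>

definition commuting_graph :: "('a, 'b) monoid_scheme \<Rightarrow> 'a set \<Rightarrow> 'a pair_pre_digraph" where
  "commuting_graph M \<Omega> =
    \<lparr> pverts = \<Omega>,
      parcs = {(u, v). u \<in> \<Omega> \<and> v \<in> \<Omega> \<and> u \<noteq> v \<and> u \<otimes>\<^bsub>M\<^esub> v = v \<otimes>\<^bsub>M\<^esub> u} \<rparr>"

lemma pair_graph_commuting_graph:
  assumes "finite \<Omega>"
  shows "pair_graph (commuting_graph M \<Omega>)"
proof -
  have "finite (parcs (commuting_graph M \<Omega>))"
    by (rule finite_subset[of _ "\<Omega> \<times> \<Omega>"]) (auto simp: commuting_graph_def assms)
  then show ?thesis
    by unfold_locales (auto simp: commuting_graph_def assms symmetric_def intro: symI)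
qed

text \<open>The shortest-path distance: every arc has weight one, so the cost of a walk is its length.\<close>

definition graph_dist :: "'a pair_pre_digraph \<Rightarrow> 'a \<Rightarrow> 'a \<Rightarrow> ereal" where
  "graph_dist \<Gamma> u v = wf_digraph.\<mu> (with_proj \<Gamma>) (\<lambda>_. 1) u v"

text \<open>The following notions are meant for finite connected graphs; in general distances may be
  infinite and \<open>card\<close> is \<open>0\<close> on infinite sets.\<close>

definition resolving_set :: "'a pair_pre_digraph \<Rightarrow> 'a set \<Rightarrow> bool" where
  "resolving_set \<Gamma> W \<longleftrightarrow> W \<subseteq> pverts \<Gamma> \<and>
    (\<forall>u\<in>pverts \<Gamma>. \<forall>v\<in>pverts \<Gamma>.
      (\<forall>w\<in>W. graph_dist \<Gamma> u w = graph_dist \<Gamma> v w) \<longrightarrow> u = v)"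

definition metric_dimension :: "'a pair_pre_digraph \<Rightarrow> nat" where
  "metric_dimension \<Gamma> = (LEAST k. \<exists>W. resolving_set \<Gamma> W \<and> card W = k)"

definition resolving_polynomial :: "'a pair_pre_digraph \<Rightarrow> int poly" where
  "resolving_polynomial \<Gamma> =
    (\<Sum>i = metric_dimension \<Gamma>..card (pverts \<Gamma>).
      monom (int (card {W. resolving_set \<Gamma> W \<and> card W = i})) i)"

end

theory Submission
  imports Defs
begin

text \<open>Since \<open>|G|\<close> is odd, the commuting graph consists of a central vertex \<open>c\<close> (the identity) joined
  to everything, the clique \<open>A\<close> of the \<open>n - 1\<close> nontrivial elements of \<open>G\<close>, and the set \<open>B\<close> of the
  \<open>n\<close> reflections, which are pendant at \<open>c\<close>. All distances are at most 2, so two vertices outside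
  \<open>W\<close> are confused exactly if they have the same neighbours in \<open>W\<close>. Hence \<open>W\<close> is resolving iff it
  misses at most one element of \<open>A\<close> and at most one of \<open>B\<close>, with \<open>c\<close> free, and the generating
  function of such sets by cardinality factors as
  \<open>(x^(n-1) + (n-1) x^(n-2)) (x^n + n x^(n-1)) (1 + x)\<close>.\<close>

section \<open>Generating functions of set families by cardinality\<close>

lemma resolving_polynomial_eq_sum:
  assumes "finite (pverts \<Gamma>)"
  shows "resolving_polynomial \<Gamma> = (\<Sum>W | resolving_set \<Gamma> W. monom 1 (card W))"
proof -
  let ?R = "{W. resolving_set \<Gamma> W}" and ?I = "{metric_dimension \<Gamma>..card (pverts \<Gamma>)}"
  have fin: "finite ?R"
    by (rule finite_subset[of _ "Pow (pverts \<Gamma>)"]) (auto simp: resolving_set_def assms)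
  \<comment> \<open>Grouping by cardinality loses no resolving set: the minimum bounds the sizes
    from below and the number of vertices from above.\<close>
  have "card ` ?R \<subseteq> ?I"
  proof (intro image_subsetI)
    fix W assume "W \<in> ?R"
    then have "metric_dimension \<Gamma> \<le> card W" "W \<subseteq> pverts \<Gamma>"
      unfolding metric_dimension_def by (auto intro: Least_le simp: resolving_set_def)
    then show "card W \<in> ?I" using assms by (simp add: card_mono)
  qed
  then have "(\<Sum>W\<in>?R. monom (1 :: int) (card W)) =
      (\<Sum>i\<in>?I. \<Sum>W | W \<in> ?R \<and> card W = i. monom 1 (card W))"
    by (intro sum.group[symmetric] fin) auto
  also have "\<dots> = resolving_polynomial \<Gamma>"
    unfolding resolving_polynomial_def
    by (intro sum.cong) (auto simp: of_nat_monom mult_monom simp flip: One_nat_def)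
  finally show ?thesis by simp
qed

text \<open>A set \<open>W\<close> corresponds to the pair of its traces on \<open>A\<close> and
  \<open>B\<close>. Their cardinalities add, so the monomials multiply. This serves twice: to split
  off the central vertex, and then to separate the clique from the pendant vertices.\<close>

lemma sum_monom_card_Un_disjoint:
  fixes A B :: "'a set"
  assumes "finite A" "finite B" "A \<inter> B = {}"
  shows "(\<Sum>W | W \<subseteq> A \<union> B \<and> P (W \<inter> A) \<and> Q (W \<inter> B). monom (1 :: 'c::comm_semiring_1) (card W)) =
    (\<Sum>S | S \<subseteq> A \<and> P S. monom 1 (card S)) * (\<Sum>T | T \<subseteq> B \<and> Q T. monom 1 (card T))"
proof -
  have "(\<Sum>S | S \<subseteq> A \<and> P S. monom 1 (card S)) * (\<Sum>T | T \<subseteq> B \<and> Q T. monom (1 :: 'c) (card T))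
      = (\<Sum>(S, T)\<in>{S. S \<subseteq> A \<and> P S} \<times> {T. T \<subseteq> B \<and> Q T}. monom 1 (card S) * monom 1 (card T))"
    by (simp add: sum_product sum.cartesian_product)
  also have "\<dots> = (\<Sum>W | W \<subseteq> A \<union> B \<and> P (W \<inter> A) \<and> Q (W \<inter> B). monom 1 (card W))"
  proof (rule sum.reindex_bij_witness[of _ "\<lambda>W. (W \<inter> A, W \<inter> B)" "\<lambda>(S, T). S \<union> T"], goal_cases)
    case (1 x)
    then show ?case using assms by auto
  next
    case (2 x)
    obtain S T where x: "x = (S, T)" by (cases x)
    with 2 have "S \<subseteq> A" "T \<subseteq> B" "P S" "Q T" by auto
    moreover from this have "(S \<union> T) \<inter> A = S" "(S \<union> T) \<inter> B = T" using assms by auto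
    ultimately show ?case by (auto simp: x)
  next
    case (3 W)
    then show ?case by auto
  next
    case (4 W)
    then show ?case by auto
  next
    case (5 x)
    obtain S T where x: "x = (S, T)" by (cases x)
    with 5 have "S \<subseteq> A" "T \<subseteq> B" by auto
    then have "card (S \<union> T) = card S + card T"
      using assms by (intro card_Un_disjoint) (auto intro: finite_subset)
    then show ?case by (simp add: x mult_monom)
  qed
  finally show ?thesis by simp
qed

text \<open>The admissible sets are \<open>A\<close> itself and one set \<open>A - {a}\<close> for
  each element \<open>a\<close>. For empty \<open>A\<close> the second monomial has coefficient 0,
  so the truncated exponent does no harm.\<close>

lemma sum_monom_card_almost_all:
  assumes "finite A"
  shows "(\<Sum>S | S \<subseteq> A \<and> card (A - S) \<le> 1. monom (1 :: int) (card S)) =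
    monom 1 (card A) + monom (int (card A)) (card A - 1)"
proof -
  have "{S. S \<subseteq> A \<and> card (A - S) \<le> 1} = insert A ((\<lambda>a. A - {a}) ` A)" (is "?L = ?R")
  proof (intro equalityI subsetI)
    fix S assume "S \<in> ?L"
    then have S: "S \<subseteq> A" "card (A - S) = 0 \<or> card (A - S) = 1" by auto
    show "S \<in> ?R"
    proof (cases "A - S = {}")
      case True
      with S show ?thesis by auto
    next
      case False
      with S assms obtain a where "A - S = {a}" by (auto simp: card_1_singleton_iff)
      with S have "a \<in> A" "S = A - {a}" by auto
      then show ?thesis by auto
    qed
  next
    fix S assume "S \<in> ?R"
    then consider "S = A" | a where "a \<in> A" "S = A - {a}" by auto
    then show "S \<in> ?L"
    proof cases
      case 2
      then have "A - S = {a}" by auto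
      then show ?thesis using 2 by auto
    qed auto
  qed
  moreover have "inj_on (\<lambda>a. A - {a}) A" by (auto simp: inj_on_def)
  moreover have "A \<notin> (\<lambda>a. A - {a}) ` A" by auto
  ultimately show ?thesis
    using assms by (simp add: sum.reindex of_nat_monom mult_monom)
qed

section \<open>Distances and resolving sets of a clique and a star sharing a vertex\<close>

lemma graph_dist_dominated:
  assumes "wf_digraph (with_proj \<Gamma>)"
    and dom: "\<And>x. x \<in> pverts \<Gamma> \<Longrightarrow> x \<noteq> c \<Longrightarrow> (x, c) \<in> parcs \<Gamma> \<and> (c, x) \<in> parcs \<Gamma>"
    and "u \<in> pverts \<Gamma>" "v \<in> pverts \<Gamma>"
  shows "graph_dist \<Gamma> u v = (if u = v then 0 else if (u, v) \<in> parcs \<Gamma> then 1 else 2)"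
proof -
  interpret wf_digraph "with_proj \<Gamma>" by fact
  have cost: "awalk_cost (\<lambda>_. 1) p = length p" for p :: "('a \<times> 'a) list"
    by (induction p) auto
  obtain p where p: "awalk u p v"
      "real (length p) = (if u = v then 0 else if (u, v) \<in> parcs \<Gamma> then 1 else 2)"
  proof -
    consider "u = v" | "u \<noteq> v" "(u, v) \<in> parcs \<Gamma>" | "u \<noteq> v" "(u, v) \<notin> parcs \<Gamma>" by blast
    then show ?thesis
    proof cases
      case 1
      then show ?thesis using assms by (intro that[of "[]"]) (auto simp: awalk_simps)
    next
      case 2
      then show ?thesis using assms by (intro that[of "[(u, v)]"]) (auto simp: awalk_simps)
    next
      case 3
      then have "(u, c) \<in> parcs \<Gamma>" "(c, v) \<in> parcs \<Gamma>" using dom assms(3,4) by metis+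
      with 3 show ?thesis
        using assms by (intro that[of "[(u, c), (c, v)]"]) (auto simp: awalk_simps)
    qed
  qed
  \<comment> \<open>An empty walk forces \<open>u = v\<close> and a single arc forces adjacency, so
    nothing is shorter than \<open>p\<close>. The rule \<open>remdups_adj.cases\<close> only serves
    to split lists into empty, singleton and longer ones.\<close>
  have "length p \<le> length q" if q: "awalk u q v" for q
  proof -
    have "u = v" if "q = []" using q that by (simp add: awalk_simps)
    moreover have "(u, v) \<in> parcs \<Gamma>" if "q = [e]" for e
      using q that by (auto simp: awalk_simps)
    ultimately show ?thesis
      using p(2) by (cases q rule: remdups_adj.cases) (auto split: if_splits)
  qed
  then have "\<mu> (\<lambda>_. 1) u v = ereal (length p)"
    unfolding \<mu>_def using p(1) by (intro antisym INF_greatest INF_lower2[of p]) (auto simp: cost)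
  then show ?thesis by (simp add: graph_dist_def p(2))
qed

text \<open>Vertices of the same class are twins, so at most one per class may be missing. The size
  bounds ensure that such a \<open>W\<close> still meets both classes, and these two landmarks tell
  the classes and \<open>c\<close> apart.\<close>

lemma resolving_set_clique_with_star:
  assumes V: "pverts \<Gamma> = A \<union> B \<union> {c}"
    and E: "parcs \<Gamma> = {(u, v). u \<in> pverts \<Gamma> \<and> v \<in> pverts \<Gamma> \<and> u \<noteq> v \<and>
      (u = c \<or> v = c \<or> u \<in> A \<and> v \<in> A)}"
    and disj: "A \<inter> B = {}" "c \<notin> A" "c \<notin> B"
    and card: "2 \<le> card A" "2 \<le> card B"
  shows "resolving_set \<Gamma> W \<longleftrightarrow>
    W \<subseteq> A \<union> B \<union> {c} \<and> card (A - W) \<le> 1 \<and> card (B - W) \<le> 1"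
proof -
  have fin: "finite A" "finite B" using card card.infinite by force+
  have "wf_digraph (with_proj \<Gamma>)" by unfold_locales (auto simp: E)
  then have dist: "graph_dist \<Gamma> u v = (if u = v then 0 else if (u, v) \<in> parcs \<Gamma> then 1 else 2)"
    if "u \<in> pverts \<Gamma>" "v \<in> pverts \<Gamma>" for u v
    using that by (intro graph_dist_dominated[of _ c]) (auto simp: E V)
  show ?thesis
  proof (intro iffI conjI; (elim conjE)?)
    assume R: "resolving_set \<Gamma> W"
    then show W: "W \<subseteq> A \<union> B \<union> {c}" by (simp add: resolving_set_def V)
    have eq: "u = v" if "u \<in> pverts \<Gamma>" "v \<in> pverts \<Gamma>"
        "\<forall>w\<in>W. graph_dist \<Gamma> u w = graph_dist \<Gamma> v w" for u v
      using R that by (auto simp: resolving_set_def)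
    \<comment> \<open>Apart from each other, two vertices of \<open>A\<close> both see
      \<open>c\<close> and the rest of \<open>A\<close>, and two of \<open>B\<close> both see only
      \<open>c\<close>.\<close>
    have *: "\<forall>w\<in>W. graph_dist \<Gamma> u w = graph_dist \<Gamma> v w"
      if "u \<in> A - W \<and> v \<in> A - W \<or> u \<in> B - W \<and> v \<in> B - W" for u v
    proof
      fix w assume "w \<in> W"
      with that W have "u \<noteq> w" "v \<noteq> w" "u \<in> pverts \<Gamma>" "v \<in> pverts \<Gamma>" "w \<in> pverts \<Gamma>"
        by (auto simp: V)
      moreover from this that disj have "(u, w) \<in> parcs \<Gamma> \<longleftrightarrow> (v, w) \<in> parcs \<Gamma>"
        by (auto simp: E)
      ultimately show "graph_dist \<Gamma> u w = graph_dist \<Gamma> v w" by (simp add: dist)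
    qed
    show "card (A - W) \<le> 1" "card (B - W) \<le> 1"
      using fin by (auto simp: card_le_Suc0_iff_eq V intro!: eq *)
  next
    assume W: "W \<subseteq> A \<union> B \<union> {c}" and AW: "card (A - W) \<le> 1" and BW: "card (B - W) \<le> 1"
    from AW BW card have "\<not> A \<subseteq> A - W" "\<not> B \<subseteq> B - W"
      using fin card_mono[of "A - W" A] card_mono[of "B - W" B] by auto
    then obtain a b where a: "a \<in> A" "a \<in> W" and b: "b \<in> B" "b \<in> W" by blast
    show "resolving_set \<Gamma> W"
      unfolding resolving_set_def
    proof (intro conjI ballI impI)
      show "W \<subseteq> pverts \<Gamma>" using W by (simp add: V)
      fix u v
      assume u: "u \<in> pverts \<Gamma>" and v: "v \<in> pverts \<Gamma>"
        and eq: "\<forall>w\<in>W. graph_dist \<Gamma> u w = graph_dist \<Gamma> v w"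
      show "u = v"
      proof (cases "u \<in> W \<or> v \<in> W")
        \<comment> \<open>A vertex of \<open>W\<close> is the only one at distance 0 from
          itself.\<close>
        case True
        then show ?thesis using eq u v by (auto simp: dist split: if_splits)
      next
        case False
        have adj: "(u, w) \<in> parcs \<Gamma> \<longleftrightarrow> (v, w) \<in> parcs \<Gamma>" if "w \<in> W" for w
        proof -
          have "w \<in> pverts \<Gamma>" "u \<noteq> w" "v \<noteq> w" using that W False by (auto simp: V)
          with eq that u v show ?thesis by (fastforce simp: dist split: if_splits)
        qed
        \<comment> \<open>Outside \<open>W\<close>, a vertex of \<open>A\<close> is adjacent to
          \<open>a\<close> but not to \<open>b\<close>, one of \<open>B\<close> to neither, and
          \<open>c\<close> to both. Hence \<open>u\<close> and \<open>v\<close> lie in the same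
          class, which has at most one vertex outside \<open>W\<close>.\<close>
        have "u \<in> A \<longleftrightarrow> v \<in> A" "u \<in> B \<longleftrightarrow> v \<in> B"
          using adj[OF a(2)] adj[OF b(2)] a b u v disj False by (auto simp: E V)
        then show ?thesis
          using False u v AW BW fin disj by (auto simp: V card_le_Suc0_iff_eq)
      qed
    qed
  qed
qed

section \<open>Commutation in the generalized dihedral group of an odd order group\<close>

lemma (in group) square_eq_one_iff_odd_order:
  assumes "odd (Coset.order G)" "g \<in> carrier G"
  shows "g \<otimes> g = \<one> \<longleftrightarrow> g = \<one>"
proof
  assume sq: "g \<otimes> g = \<one>"
  show "g = \<one>"
  proof (rule ccontr)
    assume "g \<noteq> \<one>"
    moreover have "inv g = g" using sq assms(2) by (intro inv_equality)
    \<comment> \<open>A subgroup of order 2 contradicts Lagrange's theorem in odd order.\<close>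
    ultimately have "subgroup {\<one>, g} G" "card {\<one>, g} = 2"
      using assms(2) sq by (auto intro!: subgroup.intro)
    then show False using lagrange[of "{\<one>, g}"] assms(1) by (metis dvd_triv_right)
  qed
qed (use assms in auto)

text \<open>Comparing both products, \<open>(g, 1)\<close> commutes with a reflection iff
  \<open>g\<close> is its own inverse, and the reflections \<open>(g, -1)\<close> and
  \<open>(h, -1)\<close> commute iff \<open>g \<otimes> inv h\<close> is its own inverse. In odd
  order only the identity is.\<close>

lemma commute_gen_dihedral_iff:
  fixes G (structure)
  assumes "comm_group G" "odd (Coset.order G)"
    and "(g, c) \<in> carrier (gen_dihedral G)" "(h, d) \<in> carrier (gen_dihedral G)"
  shows "(g, c) \<otimes>\<^bsub>gen_dihedral G\<^esub> (h, d) = (h, d) \<otimes>\<^bsub>gen_dihedral G\<^esub> (g, c) \<longleftrightarrow>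
    c = 1 \<and> d = 1 \<or> (g, c) = (\<one>, 1) \<or> (h, d) = (\<one>, 1) \<or> (g, c) = (h, d)"
proof -
  interpret comm_group G by fact
  have gh: "g \<in> carrier G" "h \<in> carrier G" and cd: "c = 1 \<or> c = -1" "d = 1 \<or> d = -1"
    using assms by (auto simp: gen_dihedral_def)
  have inv_eq: "x = inv x \<longleftrightarrow> x = \<one>" if "x \<in> carrier G" for x
    using that square_eq_one_iff_odd_order[OF assms(2) that]
    by (metis inv_one inv_equality r_inv)
  have mixed: "x \<otimes> y = y \<otimes> inv x \<longleftrightarrow> x = \<one>" if "x \<in> carrier G" "y \<in> carrier G" for x y
  proof -
    have "x \<otimes> y = y \<otimes> inv x \<longleftrightarrow> y \<otimes> x = y \<otimes> inv x" using that by (simp add: m_comm)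
    then show ?thesis using that inv_eq by simp
  qed
  have reflections: "x \<otimes> inv y = y \<otimes> inv x \<longleftrightarrow> x = y" if "x \<in> carrier G" "y \<in> carrier G" for x y
  proof -
    have "y \<otimes> inv x = inv (x \<otimes> inv y)" using that by (simp add: inv_mult m_comm)
    then have "x \<otimes> inv y = y \<otimes> inv x \<longleftrightarrow> x \<otimes> inv y = \<one>" using that inv_eq by simp
    also have "\<dots> \<longleftrightarrow> x = y" using that by (metis inv_solve_right' l_one one_closed)
    finally show ?thesis .
  qed
  from cd show ?thesis
  proof (elim disjE)
    assume "c = 1" "d = 1"
    then show ?thesis using gh by (simp add: gen_dihedral_def m_comm)
  next
    assume "c = 1" "d = -1"
    then show ?thesis using gh mixed[of g h] by (simp add: gen_dihedral_def int_pow_neg)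
  next
    assume "c = -1" "d = 1"
    then show ?thesis
      using gh mixed[of h g] by (auto simp: gen_dihedral_def int_pow_neg)
  next
    assume "c = -1" "d = -1"
    then show ?thesis using gh reflections[of g h] by (simp add: gen_dihedral_def int_pow_neg)
  qed
qed

theorem theorem4p3:
  fixes G :: "('a, 'b) monoid_scheme" and n :: nat and \<Gamma> :: "('a \<times> int) pair_pre_digraph"
  assumes "comm_group G"
    and "finite (carrier G)"
    and "Coset.order G = n"
    and "odd n"
    and "n > 1"
    and "\<Gamma> = commuting_graph (gen_dihedral G) (carrier (gen_dihedral G))"
  shows "resolving_polynomial \<Gamma> =
    monom 1 (2 * n - 3) *
      (monom 1 3 + monom (2 * int n) 2 + monom ((int n)^2 + int n - 1) 1
        + monom (int n * (int n - 1)) 0)"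
proof -
  interpret comm_group G by fact
  define A where "A = (carrier G - {\<one>\<^bsub>G\<^esub>}) \<times> {1 :: int}"
  define B where "B = carrier G \<times> {-1 :: int}"
  define c where "c = (\<one>\<^bsub>G\<^esub>, 1 :: int)"
  \<comment> \<open>Odd \<open>n > 1\<close> is at least 3. Writing \<open>n = k + 3\<close> removes
    truncated subtraction from the exponents and gives both classes at least two elements.\<close>
  obtain k where k: "n = k + 3"
    using assms(4,5) by (metis add.commute le_Suc_ex Suc_leI even_numeral le_neq_implies_less
        numeral_2_eq_2 numeral_3_eq_3 One_nat_def)
  have fin: "finite A" "finite B" using assms(2) by (auto simp: A_def B_def)
  have disj: "A \<inter> B = {}" "c \<notin> A" "c \<notin> B" by (auto simp: A_def B_def c_def)
  have cards: "card A = k + 2" "card B = k + 3"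
    using assms(2,3) by (auto simp: A_def B_def card_cartesian_product k Coset.order_def)
  have V: "pverts \<Gamma> = A \<union> B \<union> {c}"
    by (auto simp: assms(6) commuting_graph_def gen_dihedral_def A_def B_def c_def)
  have "parcs \<Gamma> = {(u, v). u \<in> pverts \<Gamma> \<and> v \<in> pverts \<Gamma> \<and> u \<noteq> v \<and>
      (u = c \<or> v = c \<or> u \<in> A \<and> v \<in> A)}"
  proof -
    have "u \<otimes>\<^bsub>gen_dihedral G\<^esub> v = v \<otimes>\<^bsub>gen_dihedral G\<^esub> u \<longleftrightarrow> u = c \<or> v = c \<or> u \<in> A \<and> v \<in> A"
      if "u \<noteq> v" "u \<in> carrier (gen_dihedral G)" "v \<in> carrier (gen_dihedral G)" for u v
      using that commute_gen_dihedral_iff[of G "fst u" "snd u" "fst v" "snd v"] assms(1,3,4)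
      by (cases u; cases v) (auto simp: gen_dihedral_def A_def c_def)
    then show ?thesis by (auto simp: assms(6) commuting_graph_def)
  qed
  note R = resolving_set_clique_with_star[OF V this disj]
  \<comment> \<open>The conditions are phrased through \<open>W \<inter> (A \<union> B)\<close>,
    with \<open>True\<close> for the trace on \<open>{c}\<close>, to match the product lemma:
    membership of \<open>c\<close> is free.\<close>
  have "resolving_polynomial \<Gamma> =
      (\<Sum>W | W \<subseteq> (A \<union> B) \<union> {c} \<and>
        (card (A - W \<inter> (A \<union> B)) \<le> 1 \<and> card (B - W \<inter> (A \<union> B)) \<le> 1) \<and> True. monom 1 (card W))"
  proof (subst resolving_polynomial_eq_sum)
    show "finite (pverts \<Gamma>)" using fin by (simp add: V)
    have "A - W \<inter> (A \<union> B) = A - W" "B - W \<inter> (A \<union> B) = B - W" for W by auto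
    then show "(\<Sum>W | resolving_set \<Gamma> W. monom 1 (card W)) = (\<Sum>W | W \<subseteq> (A \<union> B) \<union> {c} \<and>
        (card (A - W \<inter> (A \<union> B)) \<le> 1 \<and> card (B - W \<inter> (A \<union> B)) \<le> 1) \<and> True. monom (1::int) (card W))"
      by (simp add: R cards)
  qed
  also have "\<dots> =
      (\<Sum>S | S \<subseteq> A \<union> B \<and> card (A - S) \<le> 1 \<and> card (B - S) \<le> 1. monom 1 (card S)) *
      (\<Sum>T | T \<subseteq> {c} \<and> True. monom 1 (card T))"
    using fin disj by (intro sum_monom_card_Un_disjoint) auto
  also have "(\<Sum>S | S \<subseteq> A \<union> B \<and> card (A - S) \<le> 1 \<and> card (B - S) \<le> 1. monom (1::int) (card S)) =
      (\<Sum>S | S \<subseteq> A \<union> B \<and> card (A - S \<inter> A) \<le> 1 \<and> card (B - S \<inter> B) \<le> 1. monom 1 (card S))"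
    by (simp add: Diff_Int)
  also have "\<dots> = (\<Sum>S | S \<subseteq> A \<and> card (A - S) \<le> 1. monom 1 (card S)) *
      (\<Sum>S | S \<subseteq> B \<and> card (B - S) \<le> 1. monom 1 (card S))"
    using fin disj by (intro sum_monom_card_Un_disjoint) auto
  also have "\<dots> = (monom 1 (k + 2) + monom (int k + 2) (k + 1)) *
      (monom 1 (k + 3) + monom (int k + 3) (k + 2))"
    unfolding sum_monom_card_almost_all[OF fin(1)] sum_monom_card_almost_all[OF fin(2)] cards
    by (simp add: add.commute)
  also have "(\<Sum>T | T \<subseteq> {c} \<and> True. monom (1::int) (card T)) = monom 1 0 + monom 1 1"
  proof -
    have "{T. T \<subseteq> {c} \<and> True} = {{}, {c}}" by auto
    then show ?thesis by simp
  qed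
  \<comment> \<open>With x^(2n-3) taken out, the product is (x + n - 1)(x + n)(x + 1), whose
    expansion is the stated cubic.\<close>
  also have "(monom 1 (k + 2) + monom (int k + 2) (k + 1)) *
      (monom 1 (k + 3) + monom (int k + 3) (k + 2)) * (monom 1 0 + monom 1 1) =
    monom 1 (2 * n - 3) *
      (monom 1 3 + monom (2 * int n) 2 + monom ((int n)^2 + int n - 1) 1
        + monom (int n * (int n - 1)) 0)"
    by (rule poly_eqI) (auto simp: k distrib_left distrib_right mult_monom power2_eq_square algebra_simps)
  finally show ?thesis .
qed

end
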